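(* Let $j,m\in\mathbb{N}_0$ with $j\le m$, $\vartheta\in[0,2]$ and $K\in\mathcal{K}_{j,\vartheta}\cap\mathcal{K}_{m,\vartheta}$. Let $f$ be bounded and continuous in $B_1$ and let $u\in\mathcal{C}^{(j)}_{\vartheta,K}\cap\mathcal{C}^{(m)}_{\vartheta,K}$ be such that $$Au\stackrel{m}{=}f\quad\text{in }B_1.$$ Then there exist a function $\bar f$ and a polynomial $P$ of degree at most $m-1$ such that $\bar f=f+P$ and $Au\stackrel{j}{=}\bar f$ in $B_1$.
   Context: $\mathbb{N}_0=\{0,1,2,\dots\}$. $B_r(x)$ is the open ball in $\mathbb{R}^n$ of radius $r$ centered at $x$, $B_r:=B_r(0)$, $\Omega^c:=\mathbb{R}^n\setminus\Omega$. All functions and kernels are real-valued and Lebesgue measurable. A polynomial of degree at most $-1$ is the zero polynomial. $\chi_R$ is the characteristic function of $B_R$. For a kernel $K=K(x,y)$ the operator $A$ is $$Au(x)=\lim_{\varepsilon\searrow0}\int_{\mathbb{R}^n\setminus B_\varepsilon(x)}(u(x)-u(y))K(x,y)\,dy.$$ For $\vartheta\in[0,2]$, $\mathcal{C}_\vartheta$ is the set of $u\in L^1_{\rm loc}(\mathbb{R}^n)$ such that $u\in C(B_4)\cap L^\infty(B_4)$ if $\vartheta=0$; $u\in C^\vartheta(B_4)$ if $\vartheta\in(0,1)$; $u\in C^{0,1}(B_4)$ if $\vartheta=1$; $u\in C^{1,\vartheta-1}(B_4)$ if $\vartheta\in(1,2)$; $u\in C^{1,1}(B_4)$ if $\vartheta=2$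 (Hölder spaces with finite norm on $B_4$). For $m\in\mathbb{N}_0$, $\vartheta\in[0,2]$, $\mathcal{K}_{m,\vartheta}$ is the set of kernels $K$ such that: for all $y\in B_3^c$ the map $B_1\ni x\mapsto K(x,y)$ is $C^m(B_1)$; $\int_{\mathbb{R}^n}\min\{|x-y|^\vartheta,1\}|K(x,y)|\,dy<+\infty$ for all $x\in B_1$; and, only if $\vartheta\in(1,2]$, additionally $K(x,x+z)=K(x,x-z)$ for all $x,z\in B_1$. Given $K\in\mathcal{K}_{m,\vartheta}$, $\mathcal{C}^{(m)}_{\vartheta,K}$ is the set of $u\in\mathcal{C}_\vartheta$ such that $$\sum_{|\alpha|\le m-1}\int_{B_R\setminus B_3}|u(y)|\,|\partial^\alpha_xK(x,y)|\,dy<+\infty\ \text{ for all }R>3,\ x\in B_1,\qquad \int_{B_3^c}|u(y)|\sup_{|\alpha|=m,\,x\in B_1}|\partial_x^\alpha K(x,y)|\,dy<+\infty.$$ Definition of $\stackrel{m}{=}$: for $K\in\mathcal{K}_{m,\vartheta}$, $u\in\mathcal{C}^{(m)}_{\vartheta,K}$ and $f:B_1\to\mathbb{R}$ bounded and continuous, $Au\stackrel{m}{=}f$ in $B_1$ means that there exist a family of polynomials $P_R$ ($R>3$) with $\deg P_R\le m-1$ and functions $f_R:B_1\to\mathbb{R}$ such that $A(\chi_Ru)=f_R+P_R$ pointwise in $B_1$ and $\lim_{R\to+\infty}f_R(x)=f(x)$ for every $x\in B_1$. The relation $\stackrel{j}{=}$ is the same with $j$ in place of $m$. *)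

theory Defs
  imports "HOL-Analysis.Analysis"
begin

section \<open>Multi-indices, polynomials, partial derivatives\<close>

text \<open>A multi-index is a function \<open>\<alpha> :: 'n \<Rightarrow> nat\<close>; here \<open>mi_size \<alpha>\<close> is $|\alpha|$.
  The condition $|\alpha| \le m - 1$ is always written \<open>mi_size \<alpha> < m\<close>, so that for \<open>m = 0\<close> no
  multi-index satisfies it (truncated subtraction on \<open>nat\<close> would wrongly admit $\alpha = 0$).\<close>

definition mi_size :: "('n::finite \<Rightarrow> nat) \<Rightarrow> nat" where
  "mi_size \<alpha> = (\<Sum>i\<in>UNIV. \<alpha> i)"

lemma finite_mi_size_less: "finite {\<alpha> :: 'n::finite \<Rightarrow> nat. mi_size \<alpha> < m}"
proof (rule finite_subset)
  show "{\<alpha> :: 'n \<Rightarrow> nat. mi_size \<alpha> < m} \<subseteq> (UNIV :: 'n set) \<rightarrow>\<^sub>E {..<m}"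
  proof
    fix \<alpha> :: "'n \<Rightarrow> nat"
    assume "\<alpha> \<in> {\<alpha>. mi_size \<alpha> < m}"
    moreover have "\<alpha> i \<le> mi_size \<alpha>" for i
      unfolding mi_size_def by (rule member_le_sum) auto
    ultimately show "\<alpha> \<in> UNIV \<rightarrow>\<^sub>E {..<m}"
      by (auto simp: PiE_def intro: le_less_trans)
  qed
  show "finite ((UNIV :: 'n set) \<rightarrow>\<^sub>E {..<m})"
    by (intro finite_PiE) auto
qed

text \<open>Polynomials on $\mathbb{R}^n$ of degree at most $m - 1$; for \<open>m = 0\<close> only the zero polynomial.\<close>

definition poly_deg_less :: "nat \<Rightarrow> (real^'n::finite \<Rightarrow> real) \<Rightarrow> bool" where
  "poly_deg_less m P \<longleftrightarrow>
     (\<exists>c. \<forall>x. P x = (\<Sum>\<alpha> | mi_size \<alpha> < m. c \<alpha> * (\<Prod>i\<in>UNIV. (x $ i) ^ \<alpha> i)))"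

definition partial_deriv :: "'n::finite \<Rightarrow> (real^'n \<Rightarrow> real) \<Rightarrow> real^'n \<Rightarrow> real" where
  "partial_deriv i f x = deriv (\<lambda>t. f (x + t *\<^sub>R axis i 1)) 0"

definition partially_differentiable :: "'n::finite \<Rightarrow> (real^'n \<Rightarrow> real) \<Rightarrow> real^'n \<Rightarrow> bool" where
  "partially_differentiable i f x \<longleftrightarrow> (\<lambda>t. f (x + t *\<^sub>R axis i 1)) field_differentiable at 0"

text \<open>$C^k(S)$ for open \<open>S\<close>: all iterated partial derivatives up to order \<open>k\<close>, in every order of
  differentiation, exist and are continuous on \<open>S\<close>.\<close>

fun Ck_on :: "nat \<Rightarrow> (real^'n::finite) set \<Rightarrow> (real^'n \<Rightarrow> real) \<Rightarrow> bool" where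
  "Ck_on 0 S f \<longleftrightarrow> continuous_on S f"
| "Ck_on (Suc k) S f \<longleftrightarrow> continuous_on S f \<and>
     (\<forall>i. (\<forall>x\<in>S. partially_differentiable i f x) \<and> Ck_on k S (partial_deriv i f))"

text \<open>$\partial^\alpha f$. The index type carries no order, so some order of differentiation is chosen,
  i.e. a list of directions in which each \<open>i\<close> occurs \<open>\<alpha> i\<close> times. For $f \in C^{|\alpha|}$
  the choice is immaterial by the symmetry of mixed partial derivatives.\<close>

definition mderiv :: "('n::finite \<Rightarrow> nat) \<Rightarrow> (real^'n \<Rightarrow> real) \<Rightarrow> real^'n \<Rightarrow> real" where
  "mderiv \<alpha> f = foldr partial_deriv (SOME ds. \<forall>i. count_list ds i = \<alpha> i) f"

lemma ex_count_list: "\<exists>ds. \<forall>i. count_list ds i = (\<alpha> :: 'n::finite \<Rightarrow> nat) i"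
proof -
  obtain es :: "'n list" where es: "set es = UNIV" "distinct es"
    using finite_distinct_list[of "UNIV :: 'n set"] by auto
  have rep: "count_list (replicate n j) i = (if i = j then n else 0)" for n and i j :: 'n
    by (induction n) auto
  have "count_list (concat (map (\<lambda>i. replicate (\<alpha> i) i) xs)) i = (if i \<in> set xs then \<alpha> i else 0)"
    if "distinct xs" for xs :: "'n list" and i
    using that by (induction xs) (auto simp: rep)
  with es show ?thesis by (intro exI[of _ "concat (map (\<lambda>i. replicate (\<alpha> i) i) es)"]) auto
qed

section \<open>The function classes\<close>

text \<open>The Hoelder space $C^{k,a}(S)$ with finite norm on \<open>S\<close>.\<close>

definition holder_space :: "nat \<Rightarrow> real \<Rightarrow> (real^'n::finite) set \<Rightarrow> (real^'n \<Rightarrow> real) set" where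
  "holder_space k a S = {u. Ck_on k S u \<and>
     (\<forall>\<alpha>. mi_size \<alpha> \<le> k \<longrightarrow> bounded (mderiv \<alpha> u ` S)) \<and>
     (\<forall>\<alpha>. mi_size \<alpha> = k \<longrightarrow>
        (\<exists>C. \<forall>x\<in>S. \<forall>y\<in>S. \<bar>mderiv \<alpha> u x - mderiv \<alpha> u y\<bar> \<le> C * norm (x - y) powr a))}"

definition L1_loc :: "(real^'n::finite \<Rightarrow> real) set" where
  "L1_loc = {u. \<forall>C. compact C \<longrightarrow> set_integrable lebesgue C u}"

text \<open>$\mathcal{C}_\vartheta$, for $\vartheta \in [0,2]$.\<close>

definition C_class :: "real \<Rightarrow> (real^'n::finite \<Rightarrow> real) set" where
  "C_class \<theta> = {u \<in> L1_loc.
     (\<theta> = 0 \<longrightarrow> continuous_on (ball 0 4) u \<and>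
               (\<exists>M. AE x in lebesgue. x \<in> ball 0 4 \<longrightarrow> \<bar>u x\<bar> \<le> M)) \<and>
     (0 < \<theta> \<and> \<theta> < 1 \<longrightarrow> u \<in> holder_space 0 \<theta> (ball 0 4)) \<and>
     (\<theta> = 1 \<longrightarrow> u \<in> holder_space 0 1 (ball 0 4)) \<and>
     (1 < \<theta> \<and> \<theta> < 2 \<longrightarrow> u \<in> holder_space 1 (\<theta> - 1) (ball 0 4)) \<and>
     (\<theta> = 2 \<longrightarrow> u \<in> holder_space 1 1 (ball 0 4))}"

text \<open>$\mathcal{K}_{m,\vartheta}$. Joint Lebesgue measurability does not make every section
  $K(x,\cdot)$ measurable, and the integrals over \<open>y\<close> at fixed \<open>x\<close> need it; hence the second
  condition. In the integral, \<open>0 powr 0 = 0\<close> only affects the null set \<open>y = x\<close>.\<close>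

definition K_class :: "nat \<Rightarrow> real \<Rightarrow> (real^'n::finite \<Rightarrow> real^'n \<Rightarrow> real) set" where
  "K_class m \<theta> = {K.
     case_prod K \<in> borel_measurable lebesgue \<and>
     (\<forall>x\<in>ball 0 1. K x \<in> borel_measurable lebesgue) \<and>
     (\<forall>y\<in>- ball 0 3. Ck_on m (ball 0 1) (\<lambda>x. K x y)) \<and>
     (\<forall>x\<in>ball 0 1. (\<integral>\<^sup>+y. ennreal (min (norm (x - y) powr \<theta>) 1 * \<bar>K x y\<bar>) \<partial>lebesgue) < \<infinity>) \<and>
     (1 < \<theta> \<and> \<theta> \<le> 2 \<longrightarrow> (\<forall>x\<in>ball 0 1. \<forall>z\<in>ball 0 1. K x (x + z) = K x (x - z)))}"

text \<open>$\mathcal{C}^{(m)}_{\vartheta,K}$. The supremum is taken in \<open>ennreal\<close>: it may be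
  infinite for some \<open>y\<close>.\<close>

definition CK_class ::
    "nat \<Rightarrow> real \<Rightarrow> (real^'n::finite \<Rightarrow> real^'n \<Rightarrow> real) \<Rightarrow> (real^'n \<Rightarrow> real) set" where
  "CK_class m \<theta> K = {u \<in> C_class \<theta>.
     (\<forall>R>3. \<forall>x\<in>ball 0 1.
        (\<Sum>\<alpha> | mi_size \<alpha> < m.
           \<integral>\<^sup>+y\<in>ball 0 R - ball 0 3. ennreal (\<bar>u y\<bar> * \<bar>mderiv \<alpha> (\<lambda>x. K x y) x\<bar>) \<partial>lebesgue) < \<infinity>) \<and>
     (\<integral>\<^sup>+y\<in>- ball 0 3. ennreal \<bar>u y\<bar> *
        (SUP \<alpha>\<in>{\<alpha>. mi_size \<alpha> = m}. SUP x\<in>ball 0 1. ennreal \<bar>mderiv \<alpha> (\<lambda>x. K x y) x\<bar>)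
        \<partial>lebesgue) < \<infinity>}"

section \<open>The operator and equality up to polynomials\<close>

text \<open>\<open>A_has_value K u x L\<close> says that $Au(x)$ is well defined and equal to \<open>L\<close>: the truncated
  integrals converge absolutely for small $\varepsilon$ and tend to \<open>L\<close>.\<close>

definition A_has_value ::
    "(real^'n::finite \<Rightarrow> real^'n \<Rightarrow> real) \<Rightarrow> (real^'n \<Rightarrow> real) \<Rightarrow> real^'n \<Rightarrow> real \<Rightarrow> bool" where
  "A_has_value K u x L \<longleftrightarrow>
     (\<forall>\<^sub>F \<epsilon> in at_right 0. set_integrable lebesgue (- ball x \<epsilon>) (\<lambda>y. (u x - u y) * K x y)) \<and>
     ((\<lambda>\<epsilon>. LINT y:- ball x \<epsilon>|lebesgue. (u x - u y) * K x y) \<longlongrightarrow> L) (at_right 0)"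

text \<open>$Au \stackrel{m}{=} f$ in $B_1$. Only the values of \<open>f\<close> and of each \<open>F R\<close> on the unit ball
  matter.\<close>

definition A_eq_mod_poly ::
    "nat \<Rightarrow> (real^'n::finite \<Rightarrow> real^'n \<Rightarrow> real) \<Rightarrow> (real^'n \<Rightarrow> real) \<Rightarrow> (real^'n \<Rightarrow> real) \<Rightarrow> bool" where
  "A_eq_mod_poly m K u f \<longleftrightarrow>
     continuous_on (ball 0 1) f \<and> bounded (f ` ball 0 1) \<and>
     (\<exists>(P :: real \<Rightarrow> real^'n \<Rightarrow> real) (F :: real \<Rightarrow> real^'n \<Rightarrow> real).
        (\<forall>R>3. poly_deg_less m (P R) \<and>
           (\<forall>x\<in>ball 0 1. A_has_value K (\<lambda>y. indicator (ball 0 R) y * u y) x (F R x + P R x))) \<and>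
        (\<forall>x\<in>ball 0 1. ((\<lambda>R. F R x) \<longlongrightarrow> f x) at_top))"

end

theory Submission
  imports Defs
begin

text \<open>
  For \<open>R \<ge> 4\<close> the difference $A(\chi_R u) - A(\chi_4 u)$ is
  $-\int_{B_R \setminus B_4} u(y) K(x,y)\,dy$ on $B_1$. Interpolating $K(\cdot,y)$ by a polynomial of
  degree at most $j - 1$ through fixed nodes $z_k \in B_1$ splits this integral into a polynomial $Q_R$ and
  a remainder $r_R$. By Taylor's formula the interpolation error is at most a constant times
  $\sup_{|\alpha| = j} |\partial^\alpha_x K(\cdot,y)|$, so $r_R$ converges by dominated convergence.
  Hence $P_R - Q_R = A(\chi_4 u) + r_R - f_R$ converges pointwise on $B_1$, and its limit is a polynomial
  of degree at most $m - 1$. Interpolation, in place of the Taylor polynomial itself, needs neither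
  measurability nor integrability of the derivatives of $K$ in $y$.
\<close>

section \<open>Iterated partial derivatives\<close>

text \<open>\<open>partial_deriv\<close> differentiates at parameter 0. A shift of the parameter
  gives the derivative at every point of the line, which is what the mean value theorem
  uses.\<close>

lemma has_field_derivative_along_axis:
  assumes "partially_differentiable i f (w + s *\<^sub>R axis i 1)"
  shows "((\<lambda>t. f (w + t *\<^sub>R axis i 1)) has_field_derivative
           partial_deriv i f (w + s *\<^sub>R axis i 1)) (at s)"
proof -
  let ?g = "\<lambda>t. f (w + s *\<^sub>R axis i 1 + t *\<^sub>R axis i 1)"
  have "(?g has_field_derivative partial_deriv i f (w + s *\<^sub>R axis i 1)) (at (s - s))"
    using assms unfolding partially_differentiable_def partial_deriv_def
    by (simp add: DERIV_deriv_iff_field_differentiable)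
  then have "((\<lambda>t. ?g (t - s)) has_field_derivative
      partial_deriv i f (w + s *\<^sub>R axis i 1)) (at s)"
    using DERIV_shift[of ?g _ s "- s"] by simp
  then show ?thesis
    by (simp add: algebra_simps)
qed

text \<open>A partial derivative depends only on the values near the point. Hence iterated
  derivatives that agree merely on an open set may be differentiated once more.\<close>

lemma partial_deriv_cong_open:
  assumes "open S" "x \<in> S" and eq: "\<And>y. y \<in> S \<Longrightarrow> f y = g y"
  shows "partial_deriv i f x = partial_deriv i g x"
  unfolding partial_deriv_def
proof (rule deriv_cong_ev)
  have "((\<lambda>t. x + t *\<^sub>R axis i 1) \<longlongrightarrow> x + 0 *\<^sub>R axis i 1) (at (0::real))"
    by (intro tendsto_intros)
  \<comment> \<open>\<open>deriv_cong_ev\<close> asks for agreement on a full neighbourhood of 0,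
    not on a punctured one.\<close>
  then have "((\<lambda>t. x + t *\<^sub>R axis i 1) \<longlongrightarrow> x + 0 *\<^sub>R axis i 1) (nhds (0::real))"
    using tendsto_at_iff_tendsto_nhds[of "\<lambda>t. x + t *\<^sub>R axis i 1" 0] by blast
  then have "\<forall>\<^sub>F t in nhds (0::real). x + t *\<^sub>R axis i 1 \<in> S"
    using topological_tendstoD assms(1,2) by fastforce
  then show "\<forall>\<^sub>F t in nhds (0::real). f (x + t *\<^sub>R axis i 1) = g (x + t *\<^sub>R axis i 1)"
    by eventually_elim (rule eq)
qed simp

lemma Ck_on_imp_continuous: "Ck_on k S f \<Longrightarrow> continuous_on S f"
  by (cases k) auto

lemma Ck_on_foldr_partial_deriv:
  "Ck_on k S f \<Longrightarrow> length ds \<le> k \<Longrightarrow> Ck_on (k - length ds) S (foldr partial_deriv ds f)"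
proof (induction ds)
  case (Cons d ds)
  then have "Ck_on (Suc (k - length (d # ds))) S (foldr partial_deriv ds f)"
    by (simp add: Suc_diff_Suc)
  then show ?case by simp
qed simp

section \<open>Symmetry of mixed partial derivatives\<close>

text \<open>Two applications of the mean value theorem: first in direction \<open>i\<close> to the
  increment of \<open>f\<close> over the step \<open>h\<close> in direction \<open>j\<close>, then
  in direction \<open>j\<close> to \<open>partial_deriv i f\<close>. All points involved lie in the
  square of side \<open>h\<close> at \<open>x\<close>, hence within distance
  \<open>2 * h\<close>.\<close>

lemma second_difference_mean_value:
  fixes f :: "real^'n::finite \<Rightarrow> real"
  assumes di: "\<And>y. y \<in> ball x e \<Longrightarrow> partially_differentiable i f y"
    and dj: "\<And>y. y \<in> ball x e \<Longrightarrow> partially_differentiable j (partial_deriv i f) y"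
    and h: "0 < h" "2 * h < e"
  obtains p where "dist x p \<le> 2 * h"
    "f (x + h *\<^sub>R axis i 1 + h *\<^sub>R axis j 1) - f (x + h *\<^sub>R axis i 1) - f (x + h *\<^sub>R axis j 1) + f x
      = h\<^sup>2 * partial_deriv j (partial_deriv i f) p"
proof -
  have near: "dist x (x + s *\<^sub>R axis i 1 + t *\<^sub>R axis j 1) \<le> 2 * h"
    if "0 \<le> s" "s \<le> h" "0 \<le> t" "t \<le> h" for s t
  proof -
    have "dist x (x + s *\<^sub>R axis i 1 + t *\<^sub>R axis j 1) = norm (s *\<^sub>R axis i 1 + t *\<^sub>R axis j 1 :: real^'n)"
      by (metis add.assoc add_diff_cancel_left' dist_commute dist_norm)
    also have "\<dots> \<le> s + t"
      using that norm_triangle_ineq[of "s *\<^sub>R axis i 1 :: real^'n" "t *\<^sub>R axis j 1"]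
      by (simp add: norm_axis_1)
    finally show ?thesis using that by simp
  qed
  have inb: "x + s *\<^sub>R axis i 1 + t *\<^sub>R axis j 1 \<in> ball x e"
    if "0 \<le> s" "s \<le> h" "0 \<le> t" "t \<le> h" for s t
    using near[OF that] h by simp
  have "\<exists>s>0. s < h \<and>
     (f (x + h *\<^sub>R axis j 1 + h *\<^sub>R axis i 1) - f (x + h *\<^sub>R axis i 1)) -
     (f (x + h *\<^sub>R axis j 1 + 0 *\<^sub>R axis i 1) - f (x + 0 *\<^sub>R axis i 1)) =
     (h - 0) * (partial_deriv i f (x + h *\<^sub>R axis j 1 + s *\<^sub>R axis i 1)
                - partial_deriv i f (x + s *\<^sub>R axis i 1))"
  proof (rule MVT2)
    fix s assume s: "0 \<le> s" "s \<le> h"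
    show "((\<lambda>s. f (x + h *\<^sub>R axis j 1 + s *\<^sub>R axis i 1) - f (x + s *\<^sub>R axis i 1)) has_field_derivative
       partial_deriv i f (x + h *\<^sub>R axis j 1 + s *\<^sub>R axis i 1) - partial_deriv i f (x + s *\<^sub>R axis i 1)) (at s)"
      using s inb[of s h] inb[of s 0] h
      by (intro DERIV_diff has_field_derivative_along_axis di) (auto simp: algebra_simps)
  qed (use h in auto)
  then obtain s where s: "0 < s" "s < h" and eq1:
    "(f (x + h *\<^sub>R axis j 1 + h *\<^sub>R axis i 1) - f (x + h *\<^sub>R axis i 1)) -
     (f (x + h *\<^sub>R axis j 1 + 0 *\<^sub>R axis i 1) - f (x + 0 *\<^sub>R axis i 1)) =
     (h - 0) * (partial_deriv i f (x + h *\<^sub>R axis j 1 + s *\<^sub>R axis i 1)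
                - partial_deriv i f (x + s *\<^sub>R axis i 1))" by blast
  have "\<exists>t>0. t < h \<and>
     partial_deriv i f (x + s *\<^sub>R axis i 1 + h *\<^sub>R axis j 1) -
       partial_deriv i f (x + s *\<^sub>R axis i 1 + 0 *\<^sub>R axis j 1) =
     (h - 0) * partial_deriv j (partial_deriv i f) (x + s *\<^sub>R axis i 1 + t *\<^sub>R axis j 1)"
  proof (rule MVT2)
    fix t assume t: "0 \<le> t" "t \<le> h"
    show "((\<lambda>t. partial_deriv i f (x + s *\<^sub>R axis i 1 + t *\<^sub>R axis j 1)) has_field_derivative
       partial_deriv j (partial_deriv i f) (x + s *\<^sub>R axis i 1 + t *\<^sub>R axis j 1)) (at t)"
      using s t inb[of s t] by (intro has_field_derivative_along_axis dj) auto
  qed (use h in auto)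
  then obtain t where t: "0 < t" "t < h" and eq2:
    "partial_deriv i f (x + s *\<^sub>R axis i 1 + h *\<^sub>R axis j 1) -
       partial_deriv i f (x + s *\<^sub>R axis i 1 + 0 *\<^sub>R axis j 1) =
     (h - 0) * partial_deriv j (partial_deriv i f) (x + s *\<^sub>R axis i 1 + t *\<^sub>R axis j 1)" by blast
  show thesis
  proof (rule that)
    show "dist x (x + s *\<^sub>R axis i 1 + t *\<^sub>R axis j 1) \<le> 2 * h"
      using s t by (intro near) auto
    have comm: "x + h *\<^sub>R axis j 1 + r *\<^sub>R axis i 1 = x + r *\<^sub>R axis i 1 + h *\<^sub>R axis j 1" for r
      by (simp add: algebra_simps)
    show "f (x + h *\<^sub>R axis i 1 + h *\<^sub>R axis j 1) - f (x + h *\<^sub>R axis i 1) - f (x + h *\<^sub>R axis j 1) + f x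
      = h\<^sup>2 * partial_deriv j (partial_deriv i f) (x + s *\<^sub>R axis i 1 + t *\<^sub>R axis j 1)"
      using eq1 eq2 unfolding comm by (simp add: power2_eq_square)
  qed
qed

text \<open>The second difference is symmetric in \<open>i\<close> and \<open>j\<close>, so it
  equals \<open>h\<^sup>2\<close> times either mixed derivative, each at some point near
  \<open>x\<close>. Continuity of both forces equality at \<open>x\<close>.\<close>

lemma partial_deriv_commute:
  fixes f :: "real^'n::finite \<Rightarrow> real"
  assumes S: "open S" "x \<in> S" and C2: "Ck_on (Suc (Suc k)) S f"
  shows "partial_deriv i (partial_deriv j f) x = partial_deriv j (partial_deriv i f) x"
proof (rule ccontr)
  define F where "F = partial_deriv i (partial_deriv j f)"
  define G where "G = partial_deriv j (partial_deriv i f)"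
  define \<epsilon> where "\<epsilon> = \<bar>F x - G x\<bar> / 2"
  assume "partial_deriv i (partial_deriv j f) x \<noteq> partial_deriv j (partial_deriv i f) x"
  then have \<epsilon>: "\<epsilon> > 0" by (simp add: \<epsilon>_def F_def G_def)
  have "continuous_on S F" "continuous_on S G"
    using C2 by (auto simp: F_def G_def intro: Ck_on_imp_continuous[of k])
  then have "isCont F x" "isCont G x"
    using S continuous_on_eq_continuous_at by blast+
  then obtain d1 d2 where d: "d1 > 0" "d2 > 0"
    "\<And>y. dist y x < d1 \<Longrightarrow> dist (F y) (F x) < \<epsilon>" "\<And>y. dist y x < d2 \<Longrightarrow> dist (G y) (G x) < \<epsilon>"
    using \<epsilon> unfolding continuous_at_eps_delta by metis
  \<comment> \<open>The step \<open>h\<close> is a quarter of the smallest radius, because the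
    intermediate points are only known to lie within \<open>2 * h\<close> of
    \<open>x\<close>.\<close>
  obtain e where e: "e > 0" "ball x e \<subseteq> S"
    using S openE by blast
  define h where "h = min e (min d1 d2) / 4"
  have h: "0 < h" "2 * h < e" "2 * h < d1" "2 * h < d2"
    using e d(1,2) by (auto simp: h_def)
  have "\<And>y a b. y \<in> ball x e \<Longrightarrow> partially_differentiable a f y"
    "\<And>y a b. y \<in> ball x e \<Longrightarrow> partially_differentiable a (partial_deriv b f) y"
    using C2 e by auto
  note pd = this
  obtain p where p: "dist x p \<le> 2 * h"
    "f (x + h *\<^sub>R axis i 1 + h *\<^sub>R axis j 1) - f (x + h *\<^sub>R axis i 1) - f (x + h *\<^sub>R axis j 1) + f x
      = h\<^sup>2 * G p"
    unfolding G_def by (rule second_difference_mean_value[of x e i f j h]) (use pd h in auto)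
  obtain q where q: "dist x q \<le> 2 * h"
    "f (x + h *\<^sub>R axis j 1 + h *\<^sub>R axis i 1) - f (x + h *\<^sub>R axis j 1) - f (x + h *\<^sub>R axis i 1) + f x
      = h\<^sup>2 * F q"
    unfolding F_def by (rule second_difference_mean_value[of x e j f i h]) (use pd h in auto)
  have "h\<^sup>2 * F q = h\<^sup>2 * G p"
    unfolding p(2)[symmetric] q(2)[symmetric] by (simp add: algebra_simps)
  then have "F q = G p" using h by simp
  moreover have "dist (F q) (F x) < \<epsilon>" "dist (G p) (G x) < \<epsilon>"
    using p(1) q(1) h d(3)[of q] d(4)[of p] by (simp_all add: dist_commute)
  ultimately have "\<bar>F x - G x\<bar> < 2 * \<epsilon>"
    by (simp add: dist_real_def)
  then show False by (simp add: \<epsilon>_def)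
qed

text \<open>Induction on the length. If the outermost directions differ, the induction hypothesis
  moves each one to the front of the other tail; what remains is to exchange two derivatives of the
  common rest \<open>zs\<close>.\<close>

lemma foldr_partial_deriv_permute:
  fixes f :: "real^'n::finite \<Rightarrow> real"
  assumes S: "open S" and f: "Ck_on k S f"
  shows "x \<in> S \<Longrightarrow> length xs \<le> k \<Longrightarrow> mset xs = mset ys \<Longrightarrow>
    foldr partial_deriv xs f x = foldr partial_deriv ys f x"
proof (induction "length xs" arbitrary: xs ys x)
  case (Suc n)
  then obtain a xs' where xs: "xs = a # xs'" by (cases xs) auto
  with Suc obtain b ys' where ys: "ys = b # ys'" by (cases ys) auto
  have len: "length ys = length xs" using Suc.prems(3) by (metis size_mset)
  have cong: "partial_deriv c (foldr partial_deriv us f) x = partial_deriv c (foldr partial_deriv vs f) x"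
    if "mset us = mset vs" "length us = n" for c us vs
    using Suc.hyps(1)[of us _ vs] Suc.hyps(2) that Suc.prems S
    by (intro partial_deriv_cong_open[of S]) auto
  show ?case
  proof (cases "a = b")
    case True
    then show ?thesis
      using cong[of xs' ys' a] Suc xs ys by auto
  next
    case False
    then have "b \<in># mset xs'" using Suc.prems(3) xs ys
      by (metis insert_noteq_member mset.simps(2))
    then obtain M where M: "mset xs' = add_mset b M" by (metis insert_DiffM)
    obtain zs where zs: "mset zs = M" using ex_mset by blast
    have x': "mset xs' = mset (b # zs)" using M zs by simp
    have y': "mset ys' = mset (a # zs)"
      using Suc.prems(3) M zs xs ys by (simp add: add_mset_commute)
    have ln: "length xs' = n" "length ys' = n" using Suc.hyps(2) xs ys len by auto
    have lz: "Suc (length zs) = n" using ln x' by (metis size_mset length_Cons)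
    have "Ck_on (k - length zs) S (foldr partial_deriv zs f)"
      using Suc.prems Suc.hyps(2) lz by (intro Ck_on_foldr_partial_deriv f) auto
    \<comment> \<open>The rest \<open>zs\<close> has two directions fewer than \<open>xs\<close>, so
      two continuous orders are left for the exchange.\<close>
    moreover have "k - length zs = Suc (Suc (k - Suc n))"
      using Suc.prems Suc.hyps(2) lz by auto
    ultimately have C2: "Ck_on (Suc (Suc (k - Suc n))) S (foldr partial_deriv zs f)"
      by (simp del: Ck_on.simps)
    have "foldr partial_deriv xs f x = partial_deriv a (partial_deriv b (foldr partial_deriv zs f)) x"
      using cong[OF x' ln(1)] xs by simp
    also have "\<dots> = partial_deriv b (partial_deriv a (foldr partial_deriv zs f)) x"
      using S Suc.prems(1) C2 by (rule partial_deriv_commute)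
    also have "\<dots> = foldr partial_deriv ys f x"
      using cong[OF y' ln(2)] ys by simp
    finally show ?thesis .
  qed
qed auto

section \<open>Multi-indices and lists of directions\<close>

lemma mi_size_count_list: "mi_size (count_list ds) = length ds"
  unfolding mi_size_def
proof (induction ds)
  case (Cons d ds)
  have "(\<Sum>i\<in>UNIV. count_list (d # ds) i) = (\<Sum>i\<in>UNIV. count_list ds i + (if d = i then 1 else 0))"
    by (intro sum.cong) auto
  then show ?case using Cons by (simp add: sum.distrib)
qed simp

text \<open>The list chosen inside \<open>mderiv\<close> has the same multiplicities as
  \<open>ds\<close>, hence is a permutation of it. Bounds on \<open>mderiv\<close> thereby become
  bounds for every order of differentiation.\<close>

lemma mderiv_count_list:
  fixes f :: "real^'n::finite \<Rightarrow> real"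
  assumes "open S" "Ck_on k S f" "x \<in> S" "length ds \<le> k"
  shows "mderiv (count_list ds) f x = foldr partial_deriv ds f x"
proof -
  define es where "es = (SOME es. \<forall>i. count_list es i = count_list ds i)"
  have "\<forall>i. count_list es i = count_list ds i"
    unfolding es_def using ex_count_list by (rule someI_ex)
  then have "mset ds = mset es"
    by (intro multiset_eqI) (simp add: count_mset)
  then show ?thesis
    using foldr_partial_deriv_permute[OF assms(1-4)] by (simp add: mderiv_def es_def)
qed

section \<open>Total differentiability of C^1 functions\<close>

text \<open>The passage from \<open>x\<close> to \<open>x + h\<close> changes one coordinate at a
  time. Each change is evaluated by the mean value theorem, and continuity of the partial
  derivatives replaces the intermediate point by \<open>x\<close>.\<close>

lemma has_derivative_partial_derivs:
  fixes f :: "real^'n::finite \<Rightarrow> real"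
  assumes S: "open S" "x \<in> S" and C1: "Ck_on (Suc k) S f"
  shows "(f has_derivative (\<lambda>h. \<Sum>i\<in>UNIV. h $ i * partial_deriv i f x)) (at x)"
  unfolding has_derivative_at_alt
proof (intro conjI allI impI)
  show "bounded_linear (\<lambda>h. \<Sum>i\<in>UNIV. h $ i * partial_deriv i f x)"
    by (intro bounded_linear_sum bounded_linear_mult_left[THEN bounded_linear_compose] bounded_linear_vec_nth)
  fix e :: real assume e: "e > 0"
  \<comment> \<open>The errors add up to \<epsilon> times the sum of the absolute values of the
    components of \<open>h\<close>, which is at most \<open>CARD('n)\<close> times the norm of
    \<open>h\<close>.\<close>
  define \<epsilon> where "\<epsilon> = e / CARD('n)"
  have \<epsilon>: "\<epsilon> > 0" using e by (simp add: \<epsilon>_def)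
  obtain r where r: "r > 0" "ball x r \<subseteq> S" using S openE by blast
  have ev: "\<forall>\<^sub>F y in nhds x. \<bar>partial_deriv i f y - partial_deriv i f x\<bar> < \<epsilon>" for i
  proof -
    have "continuous_on S (partial_deriv i f)"
      using C1 by (auto intro: Ck_on_imp_continuous[of k])
    then have "(partial_deriv i f \<longlongrightarrow> partial_deriv i f x) (nhds x)"
      using S continuous_on_eq_continuous_at[of S] tendsto_at_iff_tendsto_nhds
      unfolding isCont_def by metis
    from tendstoD[OF this \<epsilon>] show ?thesis by (simp add: dist_real_def)
  qed
  have "\<forall>\<^sub>F y in nhds x. \<forall>i\<in>UNIV. \<bar>partial_deriv i f y - partial_deriv i f x\<bar> < \<epsilon>"
    by (intro eventually_ball_finite ballI ev) simp
  then obtain d0 where d0: "d0 > 0"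
    "\<And>y i. dist y x < d0 \<Longrightarrow> \<bar>partial_deriv i f y - partial_deriv i f x\<bar> < \<epsilon>"
    unfolding eventually_nhds_metric by auto
  define d where "d = min d0 r"
  have "norm (f y - f x - (\<Sum>i\<in>UNIV. (y - x) $ i * partial_deriv i f x)) \<le> e * norm (y - x)"
    if y: "norm (y - x) < d" for y
  proof -
    define h where "h = y - x"
    define p where "p I = (\<chi> i. if i \<in> I then h $ i else 0)" for I
    have bound: "\<bar>f (x + p I) - f x - (\<Sum>i\<in>I. h $ i * partial_deriv i f x)\<bar> \<le> \<epsilon> * (\<Sum>i\<in>I. \<bar>h $ i\<bar>)"
      for I :: "'n set"
    proof (induction I rule: infinite_finite_induct)
      case empty
      have "p {} = 0" by (simp add: p_def vec_eq_iff)
      then show ?case by simp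
    next
      case (insert i I)
      have pin: "p (insert i I) = p I + (h $ i) *\<^sub>R axis i 1"
        using insert by (auto simp: p_def vec_eq_iff axis_def)
      have near: "dist (x + p I + s *\<^sub>R axis i 1) x < d" if "\<bar>s\<bar> \<le> \<bar>h $ i\<bar>" for s
      proof -
        have "norm (p I + s *\<^sub>R axis i 1) \<le> norm h"
          using that insert by (intro norm_le_componentwise_cart) (auto simp: p_def axis_def)
        then show ?thesis using y by (simp add: dist_norm h_def add.assoc)
      qed
      have "\<exists>s. \<bar>s\<bar> \<le> \<bar>h $ i\<bar> \<and> f (x + p I + (h $ i) *\<^sub>R axis i 1) - f (x + p I)
          = h $ i * partial_deriv i f (x + p I + s *\<^sub>R axis i 1)"
      proof -
        \<comment> \<open>The segment is parametrised by [0,1], so that the sign of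
          \<open>h $ i\<close> needs no case distinction.\<close>
        have D: "((\<lambda>t. f (x + p I + (t * h $ i) *\<^sub>R axis i 1)) has_field_derivative
          partial_deriv i f (x + p I + (t * h $ i) *\<^sub>R axis i 1) * h $ i) (at t)"
          if "0 \<le> t" "t \<le> 1" for t
        proof -
          have "\<bar>t * h $ i\<bar> \<le> \<bar>h $ i\<bar>"
            using that by (simp add: abs_mult mult_left_le_one_le)
          from near[OF this] have "x + p I + (t * h $ i) *\<^sub>R axis i 1 \<in> S"
            using r by (auto simp: d_def dist_commute)
          then have "partially_differentiable i f (x + p I + (t * h $ i) *\<^sub>R axis i 1)"
            using C1 by simp
          from has_field_derivative_along_axis[OF this]
          show ?thesis
            by (rule DERIV_chain2) (auto intro!: derivative_eq_intros)
        qed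
        from MVT2[OF zero_less_one this] obtain t where t: "0 < t" "t < 1"
          "f (x + p I + (1 * h $ i) *\<^sub>R axis i 1) - f (x + p I + (0 * h $ i) *\<^sub>R axis i 1) =
            (1 - 0) * (partial_deriv i f (x + p I + (t * h $ i) *\<^sub>R axis i 1) * h $ i)" by blast
        show ?thesis
          using t by (intro exI[of _ "t * h $ i"]) (auto simp: abs_mult mult_left_le_one_le)
      qed
      then obtain s where s: "\<bar>s\<bar> \<le> \<bar>h $ i\<bar>" "f (x + p I + (h $ i) *\<^sub>R axis i 1) - f (x + p I)
          = h $ i * partial_deriv i f (x + p I + s *\<^sub>R axis i 1)" by blast
      have "\<bar>partial_deriv i f (x + p I + s *\<^sub>R axis i 1) - partial_deriv i f x\<bar> < \<epsilon>"
        using near[OF s(1)] by (intro d0) (simp add: d_def)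
      then have "\<bar>h $ i * (partial_deriv i f (x + p I + s *\<^sub>R axis i 1) - partial_deriv i f x)\<bar> \<le> \<epsilon> * \<bar>h $ i\<bar>"
        by (simp add: abs_mult mult.commute[of "\<bar>h $ i\<bar>"] mult_right_mono)
      moreover have "f (x + p (insert i I)) - f x - (\<Sum>i\<in>insert i I. h $ i * partial_deriv i f x)
        = (f (x + p I) - f x - (\<Sum>i\<in>I. h $ i * partial_deriv i f x))
          + h $ i * (partial_deriv i f (x + p I + s *\<^sub>R axis i 1) - partial_deriv i f x)"
        using s(2) insert by (simp add: pin algebra_simps)
      ultimately show ?case
        using insert by (simp add: distrib_left)
    qed simp
    have "p UNIV = h" by (simp add: p_def)
    with bound[of UNIV] have "\<bar>f y - f x - (\<Sum>i\<in>UNIV. h $ i * partial_deriv i f x)\<bar> \<le> \<epsilon> * (\<Sum>i\<in>UNIV. \<bar>h $ i\<bar>)"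
      by (simp add: h_def)
    also have "(\<Sum>i\<in>UNIV. \<bar>h $ i\<bar>) \<le> (\<Sum>i\<in>(UNIV::'n set). norm h)"
      by (intro sum_mono component_le_norm_cart)
    then have "\<epsilon> * (\<Sum>i\<in>UNIV. \<bar>h $ i\<bar>) \<le> \<epsilon> * (CARD('n) * norm h)"
      using \<epsilon> by simp
    finally show ?thesis by (simp add: \<epsilon>_def h_def)
  qed
  moreover have "d > 0" using d0 r by (simp add: d_def)
  ultimately show "\<exists>d>0. \<forall>y. norm (y - x) < d \<longrightarrow>
      norm (f y - f x - (\<Sum>i\<in>UNIV. (y - x) $ i * partial_deriv i f x)) \<le> e * norm (y - x)"
    by blast
qed

section \<open>Polynomials: interpolation and Taylor approximation\<close>

text \<open>With the monomials as \<open>b\<close> this is the space of polynomials of bounded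
  degree. The abstract family permits induction over its generators.\<close>

definition lin_comb :: "'a set \<Rightarrow> ('a \<Rightarrow> 'b \<Rightarrow> real) \<Rightarrow> ('b \<Rightarrow> real) \<Rightarrow> bool" where
  "lin_comb S b g \<longleftrightarrow> (\<exists>c. \<forall>x. g x = (\<Sum>a\<in>S. c a * b a x))"

lemma lin_comb_zero: "lin_comb S b (\<lambda>x. 0)"
  unfolding lin_comb_def by (rule exI[of _ "\<lambda>_. 0"]) simp

lemma lin_comb_add: "lin_comb S b g \<Longrightarrow> lin_comb S b h \<Longrightarrow> lin_comb S b (\<lambda>x. g x + h x)"
  unfolding lin_comb_def
  by (elim exE, rule_tac x="\<lambda>a. c a + ca a" in exI) (simp add: sum.distrib distrib_right)

lemma lin_comb_cmult: "lin_comb S b g \<Longrightarrow> lin_comb S b (\<lambda>x. r * g x)"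
  unfolding lin_comb_def
  by (elim exE, rule_tac x="\<lambda>a. r * c a" in exI) (simp add: sum_distrib_left mult.assoc)

lemma lin_comb_diff: "lin_comb S b g \<Longrightarrow> lin_comb S b h \<Longrightarrow> lin_comb S b (\<lambda>x. g x - h x)"
  using lin_comb_add[of S b g "\<lambda>x. (- 1) * h x"] lin_comb_cmult[of S b h "- 1"] by simp

lemma lin_comb_sum:
  "(\<And>i. i \<in> I \<Longrightarrow> lin_comb S b (g i)) \<Longrightarrow> lin_comb S b (\<lambda>x. \<Sum>i\<in>I. g i x)"
  by (induction I rule: infinite_finite_induct) (auto intro: lin_comb_zero lin_comb_add)

lemma lin_comb_base: "finite S \<Longrightarrow> a \<in> S \<Longrightarrow> lin_comb S b (b a)"
  unfolding lin_comb_def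
  by (rule exI[of _ "\<lambda>a'. if a' = a then 1 else 0"]) (simp add: if_distrib[of "\<lambda>t. t * _"] cong: if_cong)

lemma lin_comb_mono:
  assumes "finite T" "S \<subseteq> T" "lin_comb S b g"
  shows "lin_comb T b g"
proof -
  obtain c where "\<And>x. g x = (\<Sum>a\<in>S. c a * b a x)"
    using assms by (auto simp: lin_comb_def)
  then have "g = (\<lambda>x. \<Sum>a\<in>S. c a * b a x)" by auto
  then show ?thesis
    using assms by (auto intro!: lin_comb_sum lin_comb_cmult lin_comb_base)
qed

lemma lin_comb_insert:
  assumes "finite S" "a \<notin> S" "lin_comb (insert a S) b g"
  obtains r h where "lin_comb S b h" "\<And>x. g x = h x + r * b a x"
proof -
  obtain c where "\<And>x. g x = (\<Sum>a'\<in>insert a S. c a' * b a' x)"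
    using assms by (auto simp: lin_comb_def)
  with assms(1,2) show thesis
    by (intro that[of "\<lambda>x. \<Sum>a'\<in>S. c a' * b a' x" "c a"]) (auto simp: lin_comb_def)
qed

text \<open>Induction over the generators, adding a node only when the old nodes fail. The functions
  \<open>L k\<close> stay in the span, so for monomials the interpolant of an arbitrary function is
  again a polynomial of the same degree bound.\<close>

lemma lin_comb_interpolation:
  fixes b :: "'a \<Rightarrow> 'b \<Rightarrow> real"
  assumes "finite S"
  shows "\<exists>(N::nat) z L. (\<forall>k<N. z k \<in> X \<and> lin_comb S b (L k)) \<and>
    (\<forall>g x. lin_comb S b g \<longrightarrow> x \<in> X \<longrightarrow> g x = (\<Sum>k<N. g (z k) * L k x))"
  using assms
proof (induction S rule: finite_induct)
  case empty
  show ?case by (rule exI[of _ 0]) (auto simp: lin_comb_def)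
next
  case (insert a S)
  let ?V = "lin_comb (insert a S) b"
  obtain N :: nat and z L where zL: "\<And>k. k < N \<Longrightarrow> z k \<in> X" "\<And>k. k < N \<Longrightarrow> lin_comb S b (L k)"
    and rep: "\<And>g x. lin_comb S b g \<Longrightarrow> x \<in> X \<Longrightarrow> g x = (\<Sum>k<N. g (z k) * L k x)"
    using insert.IH by blast
  have V: "?V (L k)" if "k < N" for k
    using insert zL(2)[OF that] by (intro lin_comb_mono[of "insert a S" S]) auto
  \<comment> \<open>The error of the old formula on the new generator. The formula is exact on the
    span of \<open>S\<close>, so the error on any \<open>g\<close> is a multiple of
    \<open>r\<close>.\<close>
  define r where "r x = b a x - (\<Sum>k<N. b a (z k) * L k x)" for x
  have Vr: "?V r"
    unfolding r_def using insert V
    by (intro lin_comb_diff lin_comb_sum lin_comb_cmult lin_comb_base) auto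
  have err: "\<exists>s. \<forall>x\<in>X. g x = (\<Sum>k<N. g (z k) * L k x) + s * r x" if "?V g" for g
  proof -
    obtain s h where h: "lin_comb S b h" "\<And>x. g x = h x + s * b a x"
      using lin_comb_insert[OF insert(1,2) \<open>?V g\<close>] by blast
    have "g x = (\<Sum>k<N. g (z k) * L k x) + s * r x" if "x \<in> X" for x
      using rep[OF h(1) that]
      by (simp add: h(2) r_def sum.distrib sum_distrib_left algebra_simps)
    then show ?thesis by blast
  qed
  show ?case
  proof (cases "\<forall>x\<in>X. r x = 0")
    case True
    have exact: "g x = (\<Sum>k<N. g (z k) * L k x)" if "?V g" "x \<in> X" for g x
      using err[OF that(1)] that(2) True by auto
    show ?thesis
      by (intro exI[of _ N] exI[of _ z] exI[of _ L] conjI allI impI zL(1) V exact)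
  next
    case False
    then obtain x0 where x0: "x0 \<in> X" "r x0 \<noteq> 0" by blast
    \<comment> \<open>A point where the error is nonzero becomes the new node. The old
      \<open>L k\<close> are corrected to vanish there, and the new function is \<open>r\<close>
      normalised to the value 1 there.\<close>
    define z' where "z' = z(N := x0)"
    define L' where "L' k = (if k < N then (\<lambda>x. L k x - L k x0 / r x0 * r x) else (\<lambda>x. 1 / r x0 * r x))" for k
    have VL': "?V (L' k)" for k
      using V Vr by (auto simp: L'_def intro!: lin_comb_diff lin_comb_cmult simp del: times_divide_eq_left)
    have z': "z' k \<in> X" if "k < Suc N" for k
      using that zL(1) x0 by (auto simp: z'_def less_Suc_eq)
    have exact: "g x = (\<Sum>k<Suc N. g (z' k) * L' k x)" if g: "?V g" and x: "x \<in> X" for g x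
    proof -
      obtain s where s: "\<And>x. x \<in> X \<Longrightarrow> g x = (\<Sum>k<N. g (z k) * L k x) + s * r x"
        using err[OF g] by blast
      have "(\<Sum>k<N. g (z' k) * L' k x) =
          (\<Sum>k<N. g (z k) * L k x) - (\<Sum>k<N. g (z k) * L k x0) / r x0 * r x"
        by (simp add: z'_def L'_def right_diff_distrib sum_subtractf sum_distrib_right sum_divide_distrib mult.assoc)
      \<comment> \<open>The error formula at \<open>x0\<close> expresses the unknown factor
        \<open>s\<close> through the value of \<open>g\<close> at the new node.\<close>
      also have "\<dots> = (\<Sum>k<N. g (z k) * L k x) - (g x0 - s * r x0) / r x0 * r x"
        using s[OF x0(1)] by simp
      also have "\<dots> = (\<Sum>k<N. g (z k) * L k x) + s * r x - g x0 * (1 / r x0 * r x)"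
        using x0(2) by (simp add: field_simps)
      also have "\<dots> = g x - g (z' N) * L' N x"
        using s[OF x] by (simp add: z'_def L'_def)
      finally show ?thesis by simp
    qed
    show ?thesis
      by (intro exI[of _ "Suc N"] exI[of _ z'] exI[of _ L'] conjI allI impI z' VL' exact)
  qed
qed

section \<open>Polynomials of bounded degree\<close>

lemma poly_deg_less_lin_comb:
  "poly_deg_less m P \<longleftrightarrow> lin_comb {\<alpha>. mi_size \<alpha> < m} (\<lambda>\<alpha> x. \<Prod>i\<in>UNIV. (x $ i) ^ \<alpha> i) P"
  by (simp add: poly_deg_less_def lin_comb_def)

lemma poly_deg_less_mono: "j \<le> m \<Longrightarrow> poly_deg_less j P \<Longrightarrow> poly_deg_less m P"
  unfolding poly_deg_less_lin_comb
  by (erule lin_comb_mono[rotated 2]) (auto intro: finite_mi_size_less)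

text \<open>Taylor terms are indexed by lists of directions; this turns their coordinate products
  into monomials.\<close>

lemma prod_list_coordinates:
  "(\<Prod>d\<leftarrow>ds. (x :: real^'n::finite) $ d) = (\<Prod>i\<in>UNIV. (x $ i) ^ count_list ds i)"
proof (induction ds)
  case (Cons d ds)
  have "(\<Prod>i\<in>UNIV. (x $ i) ^ count_list (d # ds) i)
      = (\<Prod>i\<in>UNIV. (x $ i) ^ count_list ds i * (if d = i then x $ i else 1))"
    by (intro prod.cong) auto
  with Cons show ?case by (simp add: prod.distrib)
qed simp

lemma poly_deg_less_prod_list: "length ds < m \<Longrightarrow> poly_deg_less m (\<lambda>x. \<Prod>d\<leftarrow>ds. x $ d)"
  unfolding poly_deg_less_lin_comb prod_list_coordinates
  using lin_comb_base[OF finite_mi_size_less, of "count_list ds" m] by (simp add: mi_size_count_list)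

lemma continuous_on_poly_deg_less:
  assumes "poly_deg_less m P"
  shows "continuous_on S P"
proof -
  obtain c where "\<And>x. P x = (\<Sum>\<alpha> | mi_size \<alpha> < m. c \<alpha> * (\<Prod>i\<in>UNIV. (x $ i) ^ \<alpha> i))"
    using assms by (auto simp: poly_deg_less_def)
  then have "P = (\<lambda>x. \<Sum>\<alpha> | mi_size \<alpha> < m. c \<alpha> * (\<Prod>i\<in>UNIV. (x $ i) ^ \<alpha> i))" by auto
  then show ?thesis by (auto intro!: continuous_intros)
qed

section \<open>Taylor's formula on the unit ball\<close>

lemma finite_lists_of_length: "finite {ds :: 'n::finite list. length ds = k}"
  using finite_lists_length_eq[of "UNIV :: 'n set" k] by simp

text \<open>By the chain rule, differentiating along the ray puts one more direction in front of
  each list. Starting from the empty list, these sums are the successive derivatives of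
  \<open>g (t *\<^sub>R x)\<close> in \<open>t\<close>.\<close>

lemma has_field_derivative_ray_sum:
  fixes g :: "real^'n::finite \<Rightarrow> real"
  assumes S: "open S" and g: "Ck_on n S g" and k: "k < n" and t: "t *\<^sub>R x \<in> S"
  shows "((\<lambda>t. \<Sum>ds | length ds = k. (\<Prod>d\<leftarrow>ds. x $ d) * foldr partial_deriv ds g (t *\<^sub>R x))
    has_field_derivative
      (\<Sum>ds | length ds = Suc k. (\<Prod>d\<leftarrow>ds. x $ d) * foldr partial_deriv ds g (t *\<^sub>R x))) (at t)"
proof -
  have D: "((\<lambda>t. foldr partial_deriv ds g (t *\<^sub>R x)) has_field_derivative
      (\<Sum>i\<in>UNIV. x $ i * foldr partial_deriv (i # ds) g (t *\<^sub>R x))) (at t)"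
    if "length ds = k" for ds
  proof -
    have "Ck_on (Suc (n - Suc k)) S (foldr partial_deriv ds g)"
      using Ck_on_foldr_partial_deriv[OF g, of ds] that k by (simp add: Suc_diff_Suc)
    from has_derivative_partial_derivs[OF S t this]
    have "((\<lambda>t. foldr partial_deriv ds g (t *\<^sub>R x)) has_derivative
        (\<lambda>s. \<Sum>i\<in>UNIV. (s *\<^sub>R x) $ i * partial_deriv i (foldr partial_deriv ds g) (t *\<^sub>R x))) (at t)"
      by (rule has_derivative_compose[rotated]) (auto intro!: derivative_eq_intros)
    then show ?thesis
      unfolding has_field_derivative_def
      by (rule has_derivative_eq_rhs) (simp add: fun_eq_iff sum_distrib_left mult_ac)
  qed
  \<comment> \<open>Summing over ordered lists instead of multi-indices avoids multinomial
    coefficients.\<close>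
  have lists: "{ds :: 'n list. length ds = Suc k} = (\<lambda>(ds, i). i # ds) ` ({ds. length ds = k} \<times> UNIV)"
    by (auto simp: length_Suc_conv image_iff)
  have "(\<Sum>ds | length ds = Suc k. (\<Prod>d\<leftarrow>ds. x $ d) * foldr partial_deriv ds g (t *\<^sub>R x)) =
    (\<Sum>(ds, i)\<in>{ds. length ds = k} \<times> UNIV.
        (\<Prod>d\<leftarrow>ds. x $ d) * (x $ i * foldr partial_deriv (i # ds) g (t *\<^sub>R x)))"
    unfolding lists by (subst sum.reindex) (auto simp: inj_on_def intro!: sum.cong)
  also have "\<dots> = (\<Sum>ds | length ds = k. (\<Prod>d\<leftarrow>ds. x $ d) *
        (\<Sum>i\<in>UNIV. x $ i * foldr partial_deriv (i # ds) g (t *\<^sub>R x)))"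
    by (simp add: sum.cartesian_product[symmetric] sum_distrib_left)
  finally show ?thesis
    using D by (auto intro!: DERIV_sum DERIV_cmult)
qed

text \<open>Maclaurin's formula along the ray from 0 to \<open>x\<close>. The remainder is a sum
  over \<open>CARD('n) ^ j\<close> lists, each term at most \<open>M\<close> because the coordinates
  of \<open>x\<close> are bounded by 1. The polynomial is fixed before \<open>x\<close> and
  \<open>M\<close>.\<close>

lemma Taylor_approx_ball:
  fixes g :: "real^'n::finite \<Rightarrow> real"
  assumes g: "Ck_on j (ball 0 1) g"
  obtains T where "poly_deg_less j T"
    "\<And>x M. x \<in> ball 0 1 \<Longrightarrow> (\<And>y \<alpha>. y \<in> ball 0 1 \<Longrightarrow> mi_size \<alpha> = j \<Longrightarrow> \<bar>mderiv \<alpha> g y\<bar> \<le> M)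
      \<Longrightarrow> \<bar>g x - T x\<bar> \<le> real (CARD('n) ^ j) * M"
proof -
  define D where "D k x t = (\<Sum>ds | length ds = k. (\<Prod>d\<leftarrow>ds. x $ d) * foldr partial_deriv ds g (t *\<^sub>R x))"
    for k x t
  define T where "T x = (\<Sum>k<j. D k x 0 / fact k)" for x
  have "poly_deg_less j T"
  proof -
    have "T = (\<lambda>x. \<Sum>k<j. \<Sum>ds | length ds = k. (foldr partial_deriv ds g 0 / fact k) * (\<Prod>d\<leftarrow>ds. x $ d))"
      by (rule ext) (auto simp: T_def D_def sum_divide_distrib mult.commute intro!: sum.cong)
    then show ?thesis
      using poly_deg_less_prod_list
      by (auto simp: poly_deg_less_lin_comb simp del: times_divide_eq_left intro!: lin_comb_sum lin_comb_cmult)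
  qed
  moreover have "\<bar>g x - T x\<bar> \<le> real (CARD('n) ^ j) * M"
    if x: "x \<in> ball 0 1" and M: "\<And>y \<alpha>. y \<in> ball 0 1 \<Longrightarrow> mi_size \<alpha> = j \<Longrightarrow> \<bar>mderiv \<alpha> g y\<bar> \<le> M" for x M
  proof -
    have ray: "t *\<^sub>R x \<in> ball 0 1" if "0 \<le> t" "t \<le> 1" for t
      using that x mult_left_le_one_le[of "norm x" t] by simp
    have "\<exists>t. 0 \<le> t \<and> t \<le> 1 \<and> g x - T x = D j x t / fact j"
    proof (cases "j = 0")
      \<comment> \<open>\<open>Maclaurin\<close> requires a positive order. For order 0 the
        polynomial is 0 and the remainder at \<open>t = 1\<close> is \<open>g x\<close>
        itself.\<close>
      case True
      then show ?thesis by (intro exI[of _ 1]) (simp add: T_def D_def)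
    next
      case False
      have "\<forall>k t. k < j \<and> 0 \<le> t \<and> t \<le> 1 \<longrightarrow> DERIV (D k x) t :> D (Suc k) x t"
        unfolding D_def using has_field_derivative_ray_sum[OF open_ball g] ray by blast
      from Maclaurin[OF zero_less_one _ refl this] False
      obtain t where "0 < t" "t < 1" "D 0 x 1 = (\<Sum>k<j. D k x 0 / fact k * 1 ^ k) + D j x t / fact j * 1 ^ j"
        by blast
      moreover have "D 0 x 1 = g x" by (simp add: D_def)
      ultimately show ?thesis by (intro exI[of _ t]) (simp add: T_def)
    qed
    then obtain t where t: "0 \<le> t" "t \<le> 1" "g x - T x = D j x t / fact j" by blast
    have "\<bar>g x - T x\<bar> = \<bar>D j x t\<bar> / fact j" by (simp add: t)
    also have "\<dots> \<le> \<bar>D j x t\<bar> / 1"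
      by (intro divide_left_mono) auto
    also have "\<bar>D j x t\<bar> \<le> (\<Sum>ds | length (ds :: 'n list) = j. M)"
      unfolding D_def
    proof (intro order_trans[OF sum_abs] sum_mono)
      fix ds :: "'n list" assume "ds \<in> {ds. length ds = j}"
      then have len: "length ds = j" by simp
      have c: "\<bar>x $ d\<bar> \<le> 1" for d
        using component_le_norm_cart[of x d] x by simp
      have "\<bar>\<Prod>d\<leftarrow>ds. x $ d\<bar> \<le> 1"
      proof (induction ds)
        case (Cons d ds)
        then show ?case using c[of d] by (simp add: abs_mult mult_le_one)
      qed simp
      moreover have "\<bar>foldr partial_deriv ds g (t *\<^sub>R x)\<bar> \<le> M"
        using M[OF ray, of t "count_list ds"] mderiv_count_list[OF open_ball g ray, of t ds] t len
        by (simp add: mi_size_count_list)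
      ultimately have "\<bar>\<Prod>d\<leftarrow>ds. x $ d\<bar> * \<bar>foldr partial_deriv ds g (t *\<^sub>R x)\<bar> \<le> 1 * M"
        by (intro mult_mono) auto
      then show "\<bar>(\<Prod>d\<leftarrow>ds. x $ d) * foldr partial_deriv ds g (t *\<^sub>R x)\<bar> \<le> M"
        by (simp add: abs_mult)
    qed
    also have "(\<Sum>ds | length (ds :: 'n list) = j. M) = real (CARD('n) ^ j) * M"
      using card_lists_length_eq[of "UNIV :: 'n set" j] by simp
    finally show ?thesis by simp
  qed
  ultimately show thesis by (rule that)
qed

section \<open>The nonlocal operator\<close>

text \<open>The function is the pointwise limit of its restrictions to growing compact
  balls.\<close>

lemma L1_loc_borel_measurable:
  assumes "u \<in> L1_loc"
  shows "u \<in> borel_measurable lebesgue"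
proof (rule borel_measurable_LIMSEQ_real)
  fix n :: nat
  have "set_integrable lebesgue (cball 0 (real n)) u"
    using assms by (auto simp: L1_loc_def)
  then show "(\<lambda>x. indicator (cball 0 (real n)) x *\<^sub>R u x) \<in> borel_measurable lebesgue"
    unfolding set_integrable_def by (rule borel_measurable_integrable)
next
  fix x :: "real^'a"
  have "\<forall>\<^sub>F n in sequentially. u x = indicator (cball 0 (real n)) x *\<^sub>R u x"
    using eventually_ge_at_top[of "nat \<lceil>norm x\<rceil>"]
    by eventually_elim (simp add: nat_le_iff ceiling_le_iff)
  then show "(\<lambda>n. indicator (cball 0 (real n)) x *\<^sub>R u x) \<longlonglongrightarrow> u x"
    by (rule Lim_transform_eventually[OF tendsto_const])
qed

lemma set_integral_sum:
  fixes f :: "'i \<Rightarrow> 'a \<Rightarrow> real"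
  assumes "\<And>i. i \<in> I \<Longrightarrow> set_integrable M A (f i)"
  shows "set_integrable M A (\<lambda>x. \<Sum>i\<in>I. f i x)"
    and "(LINT x:A|M. \<Sum>i\<in>I. f i x) = (\<Sum>i\<in>I. LINT x:A|M. f i x)"
  using assms unfolding set_integrable_def set_lebesgue_integral_def
  by (simp_all add: scaleR_sum_right sum_distrib_left)

section \<open>Truncations of the operator and the interpolation remainder\<close>

text \<open>Both cutoffs equal 1 at \<open>x\<close>, so the terms with \<open>u x\<close> cancel
  and only the shell contributes. For small \<epsilon> the excised ball misses the shell, and the
  difference no longer depends on \<epsilon>. Integrability on the shell is inherited from the two
  principal values.\<close>

lemma A_has_value_truncation_diff:
  fixes K :: "real^'n::finite \<Rightarrow> real^'n \<Rightarrow> real"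
  assumes R: "1 < \<rho>" "\<rho> \<le> R" and x: "x \<in> ball 0 1"
    and a: "A_has_value K (\<lambda>y. indicator (ball 0 R) y * u y) x a"
    and b: "A_has_value K (\<lambda>y. indicator (ball 0 \<rho>) y * u y) x b"
  shows "set_integrable lebesgue (ball 0 R - ball 0 \<rho>) (\<lambda>y. u y * K x y)"
    and "a - b = - (LINT y:ball 0 R - ball 0 \<rho>|lebesgue. u y * K x y)"
proof -
  let ?g = "\<lambda>r y. (indicator (ball 0 r) x * u x - indicator (ball 0 r) y * u y) * K x y"
  let ?I = "\<lambda>r \<epsilon>. LINT y:- ball x \<epsilon>|lebesgue. ?g r y"
  let ?E = "ball 0 R - ball 0 \<rho> :: (real^'n) set"
  \<comment> \<open>As \<open>x\<close> has norm below 1, the bound \<epsilon> < \<rho> - 1 keeps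
    \<open>ball x \<epsilon>\<close> inside \<open>ball 0 \<rho>\<close>.\<close>
  have eqg: "indicator (- ball x \<epsilon>) y *\<^sub>R (?g R y - ?g \<rho> y) = - (indicator ?E y *\<^sub>R (u y * K x y))"
    if "\<epsilon> < \<rho> - 1" for \<epsilon> y
  proof -
    have "y \<in> ball 0 \<rho>" if "y \<in> ball x \<epsilon>"
    proof -
      have "norm y \<le> norm x + norm (x - y)" using norm_triangle_sub[of y x] by (simp add: norm_minus_commute)
      then show ?thesis using that \<open>\<epsilon> < \<rho> - 1\<close> x by (simp add: dist_norm)
    qed
    moreover have "x \<in> ball 0 \<rho>" "x \<in> ball 0 R" "y \<in> ball 0 \<rho> \<Longrightarrow> y \<in> ball 0 R"
      using x R by auto
    ultimately show ?thesis
      by (auto simp: indicator_def algebra_simps)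
  qed
  have "\<forall>\<^sub>F \<epsilon> in at_right 0. \<epsilon> < \<rho> - 1"
    using R eventually_at_right_real[of 0 "\<rho> - 1"] by (auto elim: eventually_mono)
  moreover have "\<forall>\<^sub>F \<epsilon> in at_right 0. set_integrable lebesgue (- ball x \<epsilon>) (?g R)"
    "\<forall>\<^sub>F \<epsilon> in at_right 0. set_integrable lebesgue (- ball x \<epsilon>) (?g \<rho>)"
    using a b by (auto simp: A_has_value_def)
  ultimately have ev: "\<forall>\<^sub>F \<epsilon> in at_right 0. set_integrable lebesgue ?E (\<lambda>y. u y * K x y) \<and>
      ?I R \<epsilon> - ?I \<rho> \<epsilon> = - (LINT y:?E|lebesgue. u y * K x y)"
  proof eventually_elim
    case (elim \<epsilon>)
    note d = set_integral_diff[OF elim(2,3)]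
    have "integrable lebesgue (\<lambda>y. - (indicator ?E y *\<^sub>R (u y * K x y)))"
      using d(1) by (simp only: set_integrable_def eqg[OF elim(1)])
    from integrable_minus[OF this] have int: "set_integrable lebesgue ?E (\<lambda>y. u y * K x y)"
      by (simp only: set_integrable_def minus_minus)
    have "?I R \<epsilon> - ?I \<rho> \<epsilon> = (\<integral>y. - (indicator ?E y *\<^sub>R (u y * K x y)) \<partial>lebesgue)"
      by (subst d(2)[symmetric]) (simp only: set_lebesgue_integral_def eqg[OF elim(1)])
    then have "?I R \<epsilon> - ?I \<rho> \<epsilon> = - (LINT y:?E|lebesgue. u y * K x y)"
      by (simp only: set_lebesgue_integral_def Bochner_Integration.integral_minus)
    with int show ?case by (rule conjI)
  qed
  from eventually_happens'[OF trivial_limit_at_right_real this]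
  show "set_integrable lebesgue ?E (\<lambda>y. u y * K x y)" by blast
  have "((\<lambda>\<epsilon>. ?I R \<epsilon> - ?I \<rho> \<epsilon>) \<longlongrightarrow> a - b) (at_right 0)"
    using a b by (intro tendsto_diff) (auto simp: A_has_value_def)
  moreover have "((\<lambda>\<epsilon>. ?I R \<epsilon> - ?I \<rho> \<epsilon>) \<longlongrightarrow> - (LINT y:?E|lebesgue. u y * K x y)) (at_right 0)"
    by (rule tendsto_eventually) (use ev in \<open>auto elim: eventually_mono\<close>)
  ultimately show "a - b = - (LINT y:?E|lebesgue. u y * K x y)"
    by (rule tendsto_unique[OF trivial_limit_at_right_real])
qed

text \<open>Interpolation is exact on polynomials of degree below \<open>j\<close>, so subtracting a
  Taylor polynomial of \<open>K\<close> in its first argument leaves the error unchanged and bounds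
  it by the derivatives of order \<open>j\<close>. That polynomial depends on \<open>y\<close> but
  enters only the pointwise bound; measurability concerns just \<open>u\<close> and finitely many
  sections of \<open>K\<close>.\<close>

lemma interpolation_remainder_integrable:
  fixes K :: "real^'n::finite \<Rightarrow> real^'n \<Rightarrow> real"
  assumes K: "K \<in> K_class j \<theta>" and u: "u \<in> CK_class j \<theta> K"
    and z: "\<And>k. k < N \<Longrightarrow> z k \<in> ball 0 1" and x: "x \<in> ball 0 1"
    and rep: "\<And>T. poly_deg_less j T \<Longrightarrow> T x = (\<Sum>k<N. T (z k) * l k)"
  shows "set_integrable lebesgue (- ball 0 3) (\<lambda>y. u y * (K x y - (\<Sum>k<N. K (z k) y * l k)))"
proof -
  define W where "W y = u y * (K x y - (\<Sum>k<N. K (z k) y * l k))" for y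
  \<comment> \<open>The Taylor constant times the amplification by interpolation: 1 for the value at
    \<open>x\<close>, plus the weights of the nodes.\<close>
  define C where "C = real (CARD('n) ^ j) * (1 + (\<Sum>k<N. \<bar>l k\<bar>))"
  define s where "s y = (SUP \<alpha>\<in>{\<alpha>. mi_size \<alpha> = j}. SUP x\<in>ball 0 1. ennreal \<bar>mderiv \<alpha> (\<lambda>x. K x y) x\<bar>)" for y
  have "0 \<le> (\<Sum>k<N. \<bar>l k\<bar>)" by (rule sum_nonneg) simp
  then have "0 < 1 + (\<Sum>k<N. \<bar>l k\<bar>)" by linarith
  then have C: "C > 0" unfolding C_def by (rule mult_pos_pos[rotated]) simp
  have um: "u \<in> borel_measurable lebesgue"
    using u by (intro L1_loc_borel_measurable) (simp add: CK_class_def C_class_def)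
  have Km: "K v \<in> borel_measurable lebesgue" if "v \<in> ball 0 1" for v
    using K that by (simp add: K_class_def)
  have Wm: "W \<in> borel_measurable lebesgue"
    unfolding W_def using z x
    by (intro borel_measurable_times borel_measurable_diff borel_measurable_sum borel_measurable_const um Km) simp_all
  have ptwise: "ennreal \<bar>W y / C\<bar> \<le> ennreal \<bar>u y\<bar> * s y" if y: "y \<in> - ball 0 3" for y
  proof (cases "u y = 0 \<or> s y = \<infinity>")
    \<comment> \<open>If \<open>u y = 0\<close> the left side vanishes; otherwise the right side is
      infinite.\<close>
    case True
    then show ?thesis by (auto simp: W_def ennreal_mult_top)
  next
    case False
    then obtain M where M: "s y = ennreal M" "M \<ge> 0"
      by (cases "s y") auto
    have "\<bar>mderiv \<alpha> (\<lambda>x. K x y) v\<bar> \<le> M" if "v \<in> ball 0 1" "mi_size \<alpha> = j" for v \<alpha>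
    proof -
      have "ennreal \<bar>mderiv \<alpha> (\<lambda>x. K x y) v\<bar> \<le> s y"
        unfolding s_def using that by (intro SUP_upper2[of \<alpha>] SUP_upper2[of v]) auto
      then show ?thesis using M by simp
    qed
    note bound = this
    have "Ck_on j (ball 0 1) (\<lambda>x. K x y)"
      using K y by (auto simp: K_class_def)
    then obtain T where T: "poly_deg_less j T"
      "\<And>v. v \<in> ball 0 1 \<Longrightarrow> \<bar>K v y - T v\<bar> \<le> real (CARD('n) ^ j) * M"
      using Taylor_approx_ball[of j "\<lambda>x. K x y"] bound by metis
    have "K x y - (\<Sum>k<N. K (z k) y * l k) = (K x y - T x) - (\<Sum>k<N. (K (z k) y - T (z k)) * l k)"
      using rep[OF T(1)] by (simp add: left_diff_distrib sum_subtractf)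
    also have "\<bar>\<dots>\<bar> \<le> \<bar>K x y - T x\<bar> + (\<Sum>k<N. \<bar>(K (z k) y - T (z k)) * l k\<bar>)"
      by (rule order_trans[OF abs_triangle_ineq4]) (intro add_left_mono sum_abs)
    also have "\<dots> \<le> real (CARD('n) ^ j) * M + (\<Sum>k<N. real (CARD('n) ^ j) * M * \<bar>l k\<bar>)"
      unfolding abs_mult using T(2) x z by (intro add_mono sum_mono mult_right_mono) auto
    also have "\<dots> = C * M"
      by (simp add: C_def sum_distrib_left algebra_simps)
    finally have "\<bar>W y\<bar> \<le> \<bar>u y\<bar> * (C * M)"
      by (simp add: W_def abs_mult mult_left_mono)
    then have "\<bar>W y / C\<bar> \<le> \<bar>u y\<bar> * M"
      using C by (simp add: field_simps)
    then show ?thesis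
      using M by (simp add: ennreal_mult[symmetric] ennreal_leI)
  qed
  \<comment> \<open>Division by \<open>C\<close> makes the majorant literally the finite integral in
    \<open>CK_class\<close>; the factor is restored at the end.\<close>
  have "integrable lebesgue (\<lambda>y. indicator (- ball 0 3) y *\<^sub>R (W y / C))"
  proof (rule integrableI_bounded)
    show "(\<lambda>y. indicator (- ball 0 3) y *\<^sub>R (W y / C)) \<in> borel_measurable lebesgue"
      using Wm by (intro borel_measurable_scaleR borel_measurable_indicator) auto
    have "(\<integral>\<^sup>+y. ennreal (norm (indicator (- ball 0 3) y *\<^sub>R (W y / C))) \<partial>lebesgue)
       \<le> (\<integral>\<^sup>+y\<in>- ball 0 3. ennreal \<bar>u y\<bar> * s y \<partial>lebesgue)"
      using ptwise by (intro nn_integral_mono) (auto simp: indicator_def)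
    also have "\<dots> < \<infinity>"
      using u by (simp add: CK_class_def s_def)
    finally show "(\<integral>\<^sup>+y. ennreal (norm (indicator (- ball 0 3) y *\<^sub>R (W y / C))) \<partial>lebesgue) < \<infinity>" .
  qed
  then have "set_integrable lebesgue (- ball 0 3) (\<lambda>y. W y / C)"
    by (simp add: set_integrable_def)
  then have "set_integrable lebesgue (- ball 0 3) (\<lambda>y. C * (W y / C))"
    by (intro set_integrable_mult_right)
  then show ?thesis using C by (simp add: W_def)
qed

lemma tendsto_set_integral_exhaustion:
  fixes g :: "real^'n::finite \<Rightarrow> real"
  assumes g: "set_integrable lebesgue (- ball 0 \<rho>) g"
  shows "((\<lambda>R. LINT y:ball 0 R - ball 0 \<rho>|lebesgue. g y) \<longlongrightarrow> (LINT y:- ball 0 \<rho>|lebesgue. g y)) at_top"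
proof -
  let ?h = "\<lambda>y. indicator (- ball 0 \<rho>) y *\<^sub>R g y"
  have eq: "indicator (ball 0 R - ball 0 \<rho>) y *\<^sub>R g y = indicator (ball 0 R) y *\<^sub>R ?h y" for R y
    by (simp add: indicator_def)
  have h: "integrable lebesgue ?h" using g by (simp add: set_integrable_def)
  show ?thesis
    unfolding set_lebesgue_integral_def eq
  proof (rule integral_dominated_convergence_at_top[where w="\<lambda>y. norm (?h y)"])
    show "\<forall>\<^sub>F R in at_top. AE y in lebesgue. norm (indicator (ball 0 R) y *\<^sub>R ?h y) \<le> norm (?h y)"
      by (intro always_eventually allI AE_I2) (auto simp: indicator_def)
    show "AE y in lebesgue. ((\<lambda>R. indicator (ball 0 R) y *\<^sub>R ?h y) \<longlongrightarrow> ?h y) at_top"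
    proof (rule AE_I2)
      fix y :: "real^'n"
      have "\<forall>\<^sub>F R in at_top. ?h y = indicator (ball 0 R) y *\<^sub>R ?h y"
        using eventually_gt_at_top[of "norm y"] by eventually_elim simp
      then show "((\<lambda>R. indicator (ball 0 R) y *\<^sub>R ?h y) \<longlongrightarrow> ?h y) at_top"
        by (rule Lim_transform_eventually[OF tendsto_const])
    qed
    show "(\<lambda>y. indicator (ball 0 R) y *\<^sub>R ?h y) \<in> borel_measurable lebesgue" for R
      by (rule borel_measurable_scaleR[OF borel_measurable_indicator borel_measurable_integrable[OF h]]) simp
  qed (use h in auto)
qed

section \<open>Interpolation and pointwise limits of polynomials\<close>

lemma poly_deg_less_interpolation:
  obtains N :: nat and z :: "nat \<Rightarrow> real^'n::finite" and L where
    "\<And>k. k < N \<Longrightarrow> z k \<in> X" "\<And>k. k < N \<Longrightarrow> poly_deg_less m (L k)"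
    "\<And>P x. poly_deg_less m P \<Longrightarrow> x \<in> X \<Longrightarrow> P x = (\<Sum>k<N. P (z k) * L k x)"
  using lin_comb_interpolation[OF finite_mi_size_less[of m], of X
      "\<lambda>\<alpha> (x::real^'n). \<Prod>i\<in>UNIV. (x $ i) ^ \<alpha> i"]
  unfolding poly_deg_less_lin_comb by blast

text \<open>On \<open>X\<close> a polynomial is recovered from its values at finitely many nodes.
  These values converge, so the limit is the interpolant of \<open>q\<close>, without any study of
  the coefficients.\<close>

lemma poly_deg_less_pointwise_limit:
  fixes p :: "'i \<Rightarrow> real^'n::finite \<Rightarrow> real"
  assumes "F \<noteq> bot"
    and p: "\<forall>\<^sub>F i in F. poly_deg_less m (p i)"
    and lim: "\<And>x. x \<in> X \<Longrightarrow> ((\<lambda>i. p i x) \<longlongrightarrow> q x) F"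
  obtains P where "poly_deg_less m P" "\<And>x. x \<in> X \<Longrightarrow> P x = q x"
proof -
  obtain N :: nat and z and L :: "nat \<Rightarrow> real^'n \<Rightarrow> real"
    where zL: "\<And>k. k < N \<Longrightarrow> z k \<in> X" "\<And>k. k < N \<Longrightarrow> poly_deg_less m (L k)"
    and rep: "\<And>P x. poly_deg_less m P \<Longrightarrow> x \<in> X \<Longrightarrow> P x = (\<Sum>k<N. P (z k) * L k x)"
    using poly_deg_less_interpolation[of X m] by blast
  define P where "P x = (\<Sum>k<N. q (z k) * L k x)" for x
  show thesis
  proof (rule that)
    show "poly_deg_less m P"
      using zL(2) unfolding P_def poly_deg_less_lin_comb
      by (intro lin_comb_sum lin_comb_cmult) auto
    fix x assume x: "x \<in> X"
    have "((\<lambda>i. \<Sum>k<N. p i (z k) * L k x) \<longlongrightarrow> P x) F"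
      unfolding P_def using zL(1) by (intro tendsto_intros lim) auto
    moreover have "\<forall>\<^sub>F i in F. (\<Sum>k<N. p i (z k) * L k x) = p i x"
      using p by eventually_elim (use rep x in simp)
    ultimately have "((\<lambda>i. p i x) \<longlongrightarrow> P x) F"
      by (rule Lim_transform_eventually)
    then show "P x = q x"
      using lim[OF x] \<open>F \<noteq> bot\<close> tendsto_unique by blast
  qed
qed

section \<open>Passage from order \<open>m\<close> to order \<open>j\<close>\<close>

theorem lemma2p14:
  fixes K :: "real^'n::finite \<Rightarrow> real^'n \<Rightarrow> real"
    and u f :: "real^'n \<Rightarrow> real"
    and j m :: nat
    and \<theta> :: real
  assumes "j \<le> m"
    and "0 \<le> \<theta>" and "\<theta> \<le> 2"
    and "K \<in> K_class j \<theta> \<inter> K_class m \<theta>"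
    and "continuous_on (ball 0 1) f" and "bounded (f ` ball 0 1)"
    and "u \<in> CK_class j \<theta> K \<inter> CK_class m \<theta> K"
    and "A_eq_mod_poly m K u f"
  shows "\<exists>(f' :: real^'n \<Rightarrow> real) P. poly_deg_less m P \<and>
           (\<forall>x\<in>ball 0 1. f' x = f x + P x) \<and> A_eq_mod_poly j K u f'"
proof -
  let ?B = "ball 0 1 :: (real^'n) set"
  \<comment> \<open>The reference radius 4 exceeds 3, so the value of the operator on that
    truncation is available.\<close>
  let ?E = "\<lambda>R. ball 0 R - ball 0 4 :: (real^'n) set"
  obtain P F where P: "\<And>R. R > 3 \<Longrightarrow> poly_deg_less m (P R)"
    and val: "\<And>R x. R > 3 \<Longrightarrow> x \<in> ?B \<Longrightarrow>
      A_has_value K (\<lambda>y. indicator (ball 0 R) y * u y) x (F R x + P R x)"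
    and F: "\<And>x. x \<in> ?B \<Longrightarrow> ((\<lambda>R. F R x) \<longlongrightarrow> f x) at_top"
    using assms(8) unfolding A_eq_mod_poly_def by blast
  obtain N :: nat and z and L :: "nat \<Rightarrow> real^'n \<Rightarrow> real"
    where zL: "\<And>k. k < N \<Longrightarrow> z k \<in> ?B" "\<And>k. k < N \<Longrightarrow> poly_deg_less j (L k)"
    and rep: "\<And>P x. poly_deg_less j P \<Longrightarrow> x \<in> ?B \<Longrightarrow> P x = (\<Sum>k<N. P (z k) * L k x)"
    using poly_deg_less_interpolation[of ?B j] by blast
  define W where "W x y = u y * (K x y - (\<Sum>k<N. K (z k) y * L k x))" for x y
  define a where "a R x = F R x + P R x" for R x
  define c where "c R k = (LINT y:?E R|lebesgue. u y * K (z k) y)" for R k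
  \<comment> \<open>The minus signs here and in \<open>r\<close> come from the shell integral, which
    enters the difference of two truncations negatively.\<close>
  define Q where "Q R x = (\<Sum>k<N. - c R k * L k x)" for R x
  define r where "r R x = - (LINT y:?E R|lebesgue. W x y)" for R x
  define r_lim where "r_lim x = - (LINT y:- ball 0 4|lebesgue. W x y)" for x
  have Wint: "set_integrable lebesgue (- ball 0 4) (W x)" if x: "x \<in> ?B" for x
  proof (rule set_integrable_subset)
    show "set_integrable lebesgue (- ball 0 3) (W x)"
      unfolding W_def using assms(4,7) zL(1) x rep[OF _ x]
      by (intro interpolation_remainder_integrable[where j=j and \<theta>=\<theta>]) auto
  qed auto
  have r: "((\<lambda>R. r R x) \<longlongrightarrow> r_lim x) at_top" if "x \<in> ?B" for x
    unfolding r_def r_lim_def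
    by (intro tendsto_minus tendsto_set_integral_exhaustion Wint that)
  have Q: "poly_deg_less j (Q R)" for R
    using zL(2) unfolding Q_def poly_deg_less_lin_comb
    by (intro lin_comb_sum lin_comb_cmult) auto
  have split: "a R x = a 4 x + Q R x + r R x" if R: "R \<ge> 4" and x: "x \<in> ?B" for R x
  proof -
    \<comment> \<open>Stated for all points of the unit ball, since it is applied both at
      \<open>x\<close> and at the nodes \<open>z k\<close>.\<close>
    have int: "set_integrable lebesgue (?E R) (\<lambda>y. u y * K v y)"
      and diff: "a R v - a 4 v = - (LINT y:?E R|lebesgue. u y * K v y)" if "v \<in> ?B" for v
      using A_has_value_truncation_diff[of 4 R v K u "a R v" "a 4 v"] val that R by (auto simp: a_def)
    have "(LINT y:?E R|lebesgue. W x y) =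
      (LINT y:?E R|lebesgue. u y * K x y - (\<Sum>k<N. L k x * (u y * K (z k) y)))"
      by (simp add: W_def right_diff_distrib sum_distrib_left mult_ac)
    also have "\<dots> = (LINT y:?E R|lebesgue. u y * K x y) -
        (LINT y:?E R|lebesgue. \<Sum>k<N. L k x * (u y * K (z k) y))"
      using int[OF x] int[OF zL(1)] by (intro set_integral_diff set_integral_sum(1) set_integrable_mult_right) auto
    also have "(LINT y:?E R|lebesgue. \<Sum>k<N. L k x * (u y * K (z k) y)) =
        (\<Sum>k<N. LINT y:?E R|lebesgue. L k x * (u y * K (z k) y))"
      using int[OF zL(1)] by (intro set_integral_sum(2) set_integrable_mult_right) auto
    also have "\<dots> = - Q R x"
      by (simp add: Q_def c_def sum_negf mult.commute)
    finally show ?thesis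
      using diff[OF x] by (simp add: r_def)
  qed
  obtain Pl where Pl: "poly_deg_less m Pl" "\<And>x. x \<in> ?B \<Longrightarrow> Pl x = a 4 x + r_lim x - f x"
  proof (rule poly_deg_less_pointwise_limit)
    show "at_top \<noteq> (bot :: real filter)" by simp
    show "\<forall>\<^sub>F R in at_top. poly_deg_less m (\<lambda>x. P R x - Q R x)"
      using eventually_gt_at_top[of 3]
    proof eventually_elim
      case (elim R)
      then show ?case
        \<comment> \<open>This is where \<open>j \<le> m\<close> enters: \<open>Q R\<close> has
          degree below \<open>j\<close>, hence below \<open>m\<close>.\<close>
        using P[OF elim] poly_deg_less_mono[OF assms(1) Q]
        unfolding poly_deg_less_lin_comb by (rule_tac lin_comb_diff)
    qed
    fix x assume x: "x \<in> ?B"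
    have "((\<lambda>R. a 4 x + r R x - F R x) \<longlongrightarrow> a 4 x + r_lim x - f x) at_top"
      by (intro tendsto_intros r F x)
    moreover have "\<forall>\<^sub>F R in at_top. a 4 x + r R x - F R x = P R x - Q R x"
      using eventually_ge_at_top[of 4]
    proof eventually_elim
      case (elim R)
      then show ?case using split[OF elim x] by (simp add: a_def)
    qed
    ultimately show "((\<lambda>R. P R x - Q R x) \<longlongrightarrow> a 4 x + r_lim x - f x) at_top"
      by (rule Lim_transform_eventually)
  qed blast
  have cont: "continuous_on S Pl" for S
    using Pl(1) by (rule continuous_on_poly_deg_less)
  \<comment> \<open>Boundedness on the open ball comes from compactness of the closed one.\<close>
  have "bounded (Pl ` cball 0 1)"
    by (intro compact_imp_bounded compact_continuous_image cont) simp
  then have "bounded (Pl ` ?B)"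
    by (rule bounded_subset) auto
  then have "bounded ((\<lambda>x. f x + Pl x) ` ?B)"
    using assms(6) by (rule bounded_plus_comp[rotated])
  moreover have "continuous_on ?B (\<lambda>x. f x + Pl x)"
    by (intro continuous_on_add cont assms(5))
  moreover have "((\<lambda>R. a R x - Q R x) \<longlongrightarrow> f x + Pl x) at_top" if x: "x \<in> ?B" for x
  proof -
    have eq: "f x + Pl x = a 4 x + r_lim x"
      using Pl(2)[OF x] by linarith
    have "((\<lambda>R. a 4 x + r R x) \<longlongrightarrow> f x + Pl x) at_top"
      unfolding eq by (intro tendsto_add tendsto_const r x)
    moreover have "\<forall>\<^sub>F R in at_top. a 4 x + r R x = a R x - Q R x"
      using eventually_ge_at_top[of 4]
    proof eventually_elim
      case (elim R)
      then show ?case using split[OF elim x] by linarith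
    qed
    ultimately show ?thesis by (rule Lim_transform_eventually)
  qed
  \<comment> \<open>The value is only regrouped, so this holds for every \<open>R > 3\<close>; the
    splitting for \<open>R \<ge> 4\<close> serves the limit alone.\<close>
  moreover have "A_has_value K (\<lambda>y. indicator (ball 0 R) y * u y) x (a R x - Q R x + Q R x)"
    if "R > 3" "x \<in> ?B" for R x
    using val[OF that] by (simp add: a_def)
  ultimately have "A_eq_mod_poly j K u (\<lambda>x. f x + Pl x)"
    unfolding A_eq_mod_poly_def using Q
    by (intro conjI exI[of _ Q] exI[of _ "\<lambda>R x. a R x - Q R x"] allI impI ballI)
  with Pl(1) show ?thesis
    by (intro exI[of _ "\<lambda>x. f x + Pl x"] exI[of _ Pl] conjI ballI refl)
qed

end
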